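(* All parameters are subject to: $N\ge1$ an integer, $0<s<1$, $N>2s$, $\ell>-2s$. Then the following hold. (i) Assume $-2s<\ell\le0$. Then there exists a unique $p_{JL}=p_{JL}(N,s,\ell)\in(p_S(N,\ell),\infty]$ such that each $p\in(1,p_{JL})$ is JL-subcritical and, in addition, if $p_{JL}<\infty$, then $p=p_{JL}$ is JL-critical and every $p>p_{JL}$ is JL-supercritical. (ii) Assume $\ell=0$. (a) When $N=1$ with $0<s<1/2$, and when $2\le N\le7$ with $0<s<1$, $p_{JL}=\infty$ holds. (b) When $N=8,9$, there exists a unique $s_N\in(0,1)$ such that $p_{JL}<\infty$ if $0<s<s_N$ and $p_{JL}=\infty$ if $s_N\le s<1$. (c) When $N\ge10$ and $0<s<1$, $p_{JL}<\infty$ always holds. (iii) Assume $-2<\ell<0$ (with $\ell>-1$ when $N=1$). (a) When $N=1$, there exists $s_{1,\ell}\in(-\ell/2,1/2)$ such that $p_{JL}<\infty$ if $-\ell/2<s<s_{1,\ell}$ and $p_{JL}=\infty$ if $s_{1,\ell}\le s<1/2$. (b) When $2\le N<10+4\ell$, there exist $s_{N,\ell},\tilde s_{N,\ell}\in(-\ell/2,1)$ with $s_{N,\ell}\le\tilde s_{N,\ell}$ such that $p_{JL}<\infty$ if $-\ell/2<s<s_{N,\ell}$ and $p_{JL}=\infty$ if $\tilde s_{N,\ell}\le s<1$. Moreover, $s_{N,\ell}=\tilde s_{N,\ell}$ holds when $2\le N\le6$. (c) When $N\ge10+4\ell$, $p_{JL}<\infty$ holds for $-\ell/2<s<1$.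
   Context: For an integer $N\ge1$ and real numbers $s,\ell$ with $0<s<1$, $N>2s$ and $\ell>-2s$, put $$p_S(N,\ell):=\frac{N+2s+2\ell}{N-2s},\qquad \lambda(\alpha):=2^{2s}\frac{\Gamma(\frac{N+2s+2\alpha}{4})\Gamma(\frac{N+2s-2\alpha}{4})}{\Gamma(\frac{N-2s-2\alpha}{4})\Gamma(\frac{N-2s+2\alpha}{4})}.$$ An exponent $p>1$ is called (for given $N,s,\ell$): - JL-subcritical if either $1<p\le p_S(N,\ell)$, or $p>p_S(N,\ell)$ and $p\,\lambda\big(\frac{N-2s}{2}-\frac{2s+\ell}{p-1}\big)>\lambda(0)$; - JL-supercritical if $p>p_S(N,\ell)$ and $p\,\lambda\big(\frac{N-2s}{2}-\frac{2s+\ell}{p-1}\big)<\lambda(0)$; - JL-critical if $p>p_S(N,\ell)$ and $p\,\lambda\big(\frac{N-2s}{2}-\frac{2s+\ell}{p-1}\big)=\lambda(0)$. In (ii) and (iii), $N$ and $\ell$ are fixed, $s$ varies over the values allowed by the constraints, and $p_{JL}=p_{JL}(N,s,\ell)$ is the number from (i). *)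

theory Defs
  imports "HOL-Analysis.Analysis"
begin

definition p_S :: "nat \<Rightarrow> real \<Rightarrow> real \<Rightarrow> real" where
  "p_S N s l = (real N + 2 * s + 2 * l) / (real N - 2 * s)"

definition lam :: "nat \<Rightarrow> real \<Rightarrow> real \<Rightarrow> real" where
  "lam N s \<alpha> = 2 powr (2 * s) *
     ((Gamma ((real N + 2 * s + 2 * \<alpha>) / 4) * Gamma ((real N + 2 * s - 2 * \<alpha>) / 4)) /
      (Gamma ((real N - 2 * s - 2 * \<alpha>) / 4) * Gamma ((real N - 2 * s + 2 * \<alpha>) / 4)))"

definition JL_subcritical :: "nat \<Rightarrow> real \<Rightarrow> real \<Rightarrow> real \<Rightarrow> bool" where
  "JL_subcritical N s l p \<longleftrightarrow>
     (1 < p \<and> p \<le> p_S N s l) \<or>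
     (1 < p \<and> p > p_S N s l \<and>
      p * lam N s ((real N - 2 * s) / 2 - (2 * s + l) / (p - 1)) > lam N s 0)"

definition JL_supercritical :: "nat \<Rightarrow> real \<Rightarrow> real \<Rightarrow> real \<Rightarrow> bool" where
  "JL_supercritical N s l p \<longleftrightarrow>
     1 < p \<and> p > p_S N s l \<and>
     p * lam N s ((real N - 2 * s) / 2 - (2 * s + l) / (p - 1)) < lam N s 0"

definition JL_critical :: "nat \<Rightarrow> real \<Rightarrow> real \<Rightarrow> real \<Rightarrow> bool" where
  "JL_critical N s l p \<longleftrightarrow>
     1 < p \<and> p > p_S N s l \<and>
     p * lam N s ((real N - 2 * s) / 2 - (2 * s + l) / (p - 1)) = lam N s 0"

definition is_p_JL :: "nat \<Rightarrow> real \<Rightarrow> real \<Rightarrow> ereal \<Rightarrow> bool" where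
  "is_p_JL N s l P \<longleftrightarrow>
     ereal (p_S N s l) < P \<and>
     (\<forall>p. 1 < p \<and> ereal p < P \<longrightarrow> JL_subcritical N s l p) \<and>
     (\<forall>q. P = ereal q \<longrightarrow>
        JL_critical N s l q \<and> (\<forall>p>q. JL_supercritical N s l p))"

text \<open>
  The description below is meaningful only where \<^const>\<open>is_p_JL\<close> has exactly one solution,
  that is, for admissible parameters with \<open>-2s < l \<le> 0\<close>.
\<close>

definition p_JL :: "nat \<Rightarrow> real \<Rightarrow> real \<Rightarrow> ereal" where
  "p_JL N s l = (THE P. is_p_JL N s l P)"

end

theory Submission
  imports Defs
begin

text \<open>
  Write \<open>a\<close> for half the dimension \<open>N\<close> and \<open>m = l / 2\<close>, and replace \<open>p\<close> by \<open>t = (s + m) / (p - 1)\<close>. The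
  arguments of the Gamma functions become affine in \<open>t\<close>, and the factor \<open>p = (t + s + m) / t\<close> cancels the
  pole of \<open>Gamma t\<close>, so that the logarithm of \<open>p * lam\<close> extends to \<open>t = 0\<close>, that is, to \<open>p = \<infinity>\<close>. Because
  the digamma function is strictly concave and \<open>m \<le> 0\<close>, this logarithm is strictly concave in \<open>t\<close>
  (\<open>log_lhs_greater_min\<close>), and at \<open>p = p_S\<close> it exceeds that of \<open>lam N s 0\<close>. Hence it
  crosses this level at most once, which gives existence of the Joseph-Lundgren exponent, and the exponent
  is finite exactly if the limit at \<open>p = \<infinity>\<close> lies below the level, that is, if
  \<open>margin a m s = ln (s + m) - ln s + margin0 a s\<close> is negative (\<open>p_JL_finite_iff\<close>).

  The sign of \<open>margin\<close> is determined by treating \<open>a\<close> as a real parameter. Concavity of the digamma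
  function shows that \<open>margin0\<close> decreases in \<open>a\<close>, that its derivative in \<open>s\<close> decreases in \<open>a\<close> (where
  \<open>3 * s\<close> is at most the larger parameter), and that this derivative increases in \<open>s\<close> if \<open>a \<ge> 3\<close>. Moreover \<open>margin0 a 0 = 0\<close> and \<open>margin0 a 1 = ln (4 / (a - 1))\<close>
  for \<open>a > 1\<close>.

  For \<open>l = 0\<close> the margin is \<open>margin0\<close>. If \<open>a \<le> 7/2\<close> it is nondecreasing in \<open>s\<close>, since its slope in \<open>s\<close> is at
  least the slope at \<open>s = 0\<close> for \<open>a = 7/2\<close>, which is positive but small. If \<open>4 \<le> a < 5\<close> the slope at 0 is
  negative and the value at 1 positive, so convexity gives exactly one sign change. For \<open>a = 5\<close> the values
  at 0 and 1 are both 0, so the margin is negative in between, and then also for \<open>a > 5\<close>.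

  For \<open>l < 0\<close> the margin tends to \<open>-\<infinity>\<close> as \<open>s\<close> decreases to \<open>- m\<close>; at the other end of the range of \<open>s\<close>
  it is positive if \<open>1 < a < 5 + 4 * m\<close>, and tends to \<open>\<infinity>\<close> if \<open>a \<le> 1\<close>. This gives the two thresholds, and
  they can be chosen equal if \<open>a \<le> 7/2\<close>, because then the margin is strictly increasing in \<open>s\<close>. If
  \<open>a \<ge> 5 + 4 * m\<close>, monotonicity in \<open>a\<close> reduces the claim to \<open>a = 5 + 4 * m\<close>; for fixed \<open>s\<close> the margin
  increases with \<open>m\<close> along this line (\<open>margin_neg_large_dim\<close>) up to the negative number \<open>margin0 5 s\<close>.
\<close>

section \<open>Increments of the digamma function\<close>

text \<open>
  That \<open>Digamma (y + d) - Digamma y\<close> decreases in \<open>y\<close> (strict concavity of the digamma function)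
  is behind both the monotonicity in the dimension and the convexity in \<open>s\<close> established below.
\<close>

lemma Digamma_increment_strict_antimono:
  fixes x y d :: real
  assumes "0 < x" "x < y" "0 < d"
  shows "Digamma (y + d) - Digamma y < Digamma (x + d) - Digamma x"
proof -
  have der: "((\<lambda>u. Digamma (u + d) - Digamma u) has_real_derivative
               (Polygamma 1 (u + d) - Polygamma 1 u)) (at u)" if "x \<le> u" for u
    using that assms by (auto intro!: derivative_eq_intros elim!: nonpos_Ints_cases)
  show ?thesis
  proof (rule DERIV_neg_imp_decreasing[OF \<open>x < y\<close>])
    fix u assume u: "x \<le> u" "u \<le> y"
    have "Polygamma 1 (u + d) - Polygamma 1 u < 0"
      using Polygamma_real_strict_antimono[of u "u + d" 1] u assms by simp
    with der[OF u(1)] show "\<exists>D. ((\<lambda>u. Digamma (u + d) - Digamma u) has_real_derivative D) (at u) \<and> D < 0"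
      by blast
  qed
qed

lemma Digamma_increment_antimono:
  fixes x y d :: real
  assumes "0 < x" "x \<le> y" "0 < d"
  shows "Digamma (y + d) - Digamma y \<le> Digamma (x + d) - Digamma x"
  using Digamma_increment_strict_antimono[of x y d] assms by (cases "x = y") auto

lemma tendsto_divide_add_nat: "(\<lambda>n. c / (y + real n)) \<longlonglongrightarrow> 0" for c y :: real
  by (intro tendsto_divide_0[OF tendsto_const] filterlim_at_top_imp_at_infinity
      filterlim_tendsto_add_at_top[OF tendsto_const] filterlim_real_sequentially)

lemma Digamma_increment_tendsto_0:
  fixes y d :: real
  assumes "0 < y" "0 < d" "d \<le> 1"
  shows "(\<lambda>n. Digamma (y + real n + d) - Digamma (y + real n)) \<longlonglongrightarrow> 0"
proof (rule tendsto_sandwich[where f = "\<lambda>_. 0" and h = "\<lambda>n. 1 / (y + real n)"])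
  show "(\<lambda>n. 1 / (y + real n)) \<longlonglongrightarrow> 0"
    by (rule tendsto_divide_add_nat)
  show "\<forall>\<^sub>F n in sequentially. 0 \<le> Digamma (y + real n + d) - Digamma (y + real n)"
    using assms Digamma_real_mono by (intro always_eventually) auto
  show "\<forall>\<^sub>F n in sequentially. Digamma (y + real n + d) - Digamma (y + real n) \<le> 1 / (y + real n)"
  proof (intro always_eventually allI)
    fix n
    have "Digamma (y + real n + d) \<le> Digamma (y + real n + 1)"
      using assms by (intro Digamma_real_mono) auto
    then show "Digamma (y + real n + d) - Digamma (y + real n) \<le> 1 / (y + real n)"
      using Digamma_plus1[of "y + real n"] assms by simp
  qed
qed auto

lemma nonneg_if_telescoping:
  fixes f :: "real \<Rightarrow> real"
  assumes "\<And>x. y \<le> x \<Longrightarrow> f (x + 1) \<le> f x"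
    and "(\<lambda>n. f (y + real n)) \<longlonglongrightarrow> 0"
  shows "0 \<le> f y"
proof -
  have "f (y + real n) \<le> f y" for n
  proof (induction n)
    case (Suc n)
    then show ?case using assms(1)[of "y + real n"] by (simp add: algebra_simps)
  qed simp
  with assms(2) show ?thesis by (meson LIMSEQ_le_const2)
qed

text \<open>
  Elementary bounds for increments of length \<open>d \<le> 1\<close>, both with equality at \<open>d = 1\<close>. In each case the
  difference of the two sides tends to 0 along \<open>y, y + 1, y + 2, \<dots>\<close> and is monotone along this
  sequence by the functional equation.
\<close>

lemma Digamma_increment_ge:
  fixes y d :: real
  assumes "0 < y" "0 < d" "d \<le> 1"
  shows "d / y \<le> Digamma (y + d) - Digamma y"
proof -
  define f where "f x = (Digamma (x + d) - Digamma x) - d / x" for x :: real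
  have "0 \<le> f y"
  proof (rule nonneg_if_telescoping[where f = f])
    fix x assume "y \<le> x"
    then have x: "0 < x" using assms by simp
    have "Digamma (x + 1 + d) = Digamma (x + d) + 1 / (x + d)"
      using Digamma_plus1[of "x + d"] x assms by (simp add: algebra_simps)
    then have "f x - f (x + 1) = (1 / x - 1 / (x + d)) - (d / x - d / (x + 1))"
      using Digamma_plus1[of x] x by (simp add: f_def)
    also have "\<dots> = d / (x * (x + d)) - d / (x * (x + 1))"
      using x assms by (simp add: field_simps)
    also have "\<dots> \<ge> 0"
      using x assms by (simp add: frac_le)
    finally show "f (x + 1) \<le> f x" by simp
  next
    have "(\<lambda>n. d / (y + real n)) \<longlonglongrightarrow> 0" by (rule tendsto_divide_add_nat)
    then show "(\<lambda>n. f (y + real n)) \<longlonglongrightarrow> 0"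
      unfolding f_def using tendsto_diff[OF Digamma_increment_tendsto_0[OF assms]] by force
  qed
  then show ?thesis by (simp add: f_def)
qed

lemma Digamma_increment_le:
  fixes y d :: real
  assumes "0 < d" "d \<le> 1" "(1 - d) / 2 < y"
  shows "Digamma (y + d) - Digamma y \<le> d / (y - (1 - d) / 2)"
proof -
  define c where "c = (1 - d) / 2"
  define f where "f x = d / (x - c) - (Digamma (x + d) - Digamma x)" for x :: real
  have c: "0 \<le> c" "c < y" using assms by (auto simp: c_def)
  have "0 \<le> f y"
  proof (rule nonneg_if_telescoping[where f = f])
    fix x assume "y \<le> x"
    then have x: "c < x" "0 < x" using c by auto
    have "Digamma (x + 1 + d) = Digamma (x + d) + 1 / (x + d)"
      using Digamma_plus1[of "x + d"] x assms by (simp add: algebra_simps)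
    then have "f x - f (x + 1) = (d / (x - c) - d / (x + 1 - c)) - (1 / x - 1 / (x + d))"
      using Digamma_plus1[of x] x by (simp add: f_def)
    also have "\<dots> = d / ((x - c) * (x + 1 - c)) - d / (x * (x + d))"
      using x assms by (simp add: divide_simps) (simp add: algebra_simps)
    also have "\<dots> \<ge> 0"
    proof -
      have "(x - c) * (x + 1 - c) \<le> x * (x + d)"
      proof -
        have "x * (x + d) - (x - c) * (x + 1 - c) = c * (1 - c)"
          unfolding c_def by (simp add: field_simps)
        also have "\<dots> \<ge> 0" using c assms by (simp add: c_def)
        finally show ?thesis by simp
      qed
      then show ?thesis using x assms by (simp add: frac_le)
    qed
    finally show "f (x + 1) \<le> f x" by simp
  next
    have "(\<lambda>n. d / (y + real n - c)) \<longlonglongrightarrow> 0"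
      using tendsto_divide_add_nat[of d "y - c"] by (simp add: algebra_simps)
    then show "(\<lambda>n. f (y + real n)) \<longlonglongrightarrow> 0"
      unfolding f_def using tendsto_diff[OF _ Digamma_increment_tendsto_0[of y d]] assms c by force
  qed
  then show ?thesis by (simp add: f_def c_def)
qed

text \<open>
  A function with strictly increasing derivative stays strictly below the larger of two of its values
  between the two points. This is the only form in which strict convexity is needed.
\<close>

lemma between_less_max_if_deriv_strict_mono:
  fixes f f' :: "real \<Rightarrow> real"
  assumes "x < y" "y < z"
    and der: "\<And>u. x \<le> u \<Longrightarrow> u \<le> z \<Longrightarrow> (f has_real_derivative f' u) (at u)"
    and mono: "\<And>u v. x < u \<Longrightarrow> u < v \<Longrightarrow> v < z \<Longrightarrow> f' u < f' v"
  shows "f y < max (f x) (f z)"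
proof (rule ccontr)
  assume "\<not> ?thesis"
  then have le: "f x \<le> f y" "f z \<le> f y" by auto
  obtain u where u: "x < u" "u < y" "f y - f x = (y - x) * f' u"
    using MVT2[of x y f f'] assms(1,2) der by auto
  obtain v where v: "y < v" "v < z" "f z - f y = (z - y) * f' v"
    using MVT2[of y z f f'] assms(1,2) der by auto
  have "0 \<le> (y - x) * f' u" using u le by simp
  then have "0 \<le> f' u" using assms(1) by (simp add: zero_le_mult_iff)
  moreover have "(z - y) * f' v \<le> 0" using v le by simp
  then have "f' v \<le> 0" using assms(2) by (simp add: mult_le_0_iff)
  ultimately show False using mono[of u v] u v by auto
qed

section \<open>The margin for \<open>l = 0\<close>\<close>

text \<open>
  With \<open>a\<close> for half the dimension, \<open>margin0 a s\<close> is the logarithm of the limit, as \<open>p\<close> tends to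
  infinity, of the quotient of the two sides of the inequality that defines JL-subcriticality, in the
  case \<open>l = 0\<close>. It is studied for real \<open>a > s\<close>, so that dimensions can be compared continuously.
  The derivative with respect to \<open>s\<close> is \<open>dmargin0 a s\<close>.
\<close>

definition margin0 :: "real \<Rightarrow> real \<Rightarrow> real" where
  "margin0 a s = ln_Gamma a + ln_Gamma (1 + s) - ln_Gamma (a - s)
     - 2 * ln_Gamma ((a + s) / 2) + 2 * ln_Gamma ((a - s) / 2)"

definition dmargin0 :: "real \<Rightarrow> real \<Rightarrow> real" where
  "dmargin0 a s = Digamma (1 + s) + Digamma (a - s) - Digamma ((a + s) / 2) - Digamma ((a - s) / 2)"

lemma margin0_deriv:
  assumes "-1 < s" "-a < s" "s < a"
  shows "(margin0 a has_real_derivative dmargin0 a s) (at s)"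
  unfolding margin0_def dmargin0_def using assms
  by (auto intro!: derivative_eq_intros simp: field_simps)

lemma margin0_deriv_dim:
  assumes "0 \<le> s" "s < a"
  shows "((\<lambda>a. margin0 a s) has_real_derivative
    (Digamma a - Digamma (a - s) - (Digamma ((a + s) / 2) - Digamma ((a - s) / 2)))) (at a)"
  unfolding margin0_def using assms
  by (auto intro!: derivative_eq_intros simp: field_simps)

lemma margin0_strict_antimono_dim:
  assumes "0 < s" "s < a" "a < b"
  shows "margin0 b s < margin0 a s"
proof (rule DERIV_neg_imp_decreasing[OF \<open>a < b\<close>])
  fix u assume u: "a \<le> u" "u \<le> b"
  have e: "(u - s) / 2 + s = (u + s) / 2" by (simp add: field_simps)
  have "Digamma (u - s + s) - Digamma (u - s) < Digamma ((u - s) / 2 + s) - Digamma ((u - s) / 2)"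
    using u assms by (intro Digamma_increment_strict_antimono) auto
  then show "\<exists>D. ((\<lambda>a. margin0 a s) has_real_derivative D) (at u) \<and> D < 0"
    using margin0_deriv_dim[of s u] u assms e by (intro exI conjI) auto
qed

lemma margin0_antimono_dim: "0 < s \<Longrightarrow> s < a \<Longrightarrow> a \<le> b \<Longrightarrow> margin0 b s \<le> margin0 a s"
  using margin0_strict_antimono_dim[of s a b] by (cases "a = b") auto

text \<open>
  The increment of the term \<open>Digamma (a - s)\<close> over \<open>b - a\<close> is split into two increments of half that
  length, one to be compared with each of the two terms whose argument contains a division by 2.
\<close>

lemma dmargin0_strict_antimono_dim:
  assumes "0 \<le> s" "s < a" "a < b" "3 * s \<le> b"
  shows "dmargin0 b s < dmargin0 a s"
proof -
  define d where "d = (b - a) / 2"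
  have d: "0 < d" "b = a + 2 * d" using assms by (auto simp: d_def field_simps)
  have e: "b - s = a - s + d + d" "(a - s + d + d) / 2 = (a - s) / 2 + d" "(b + s) / 2 = (a + s) / 2 + d"
    using d by (auto simp: field_simps)
  have "Digamma (a - s + d) - Digamma (a - s) < Digamma ((a - s) / 2 + d) - Digamma ((a - s) / 2)"
    using assms d by (intro Digamma_increment_strict_antimono) auto
  moreover have "Digamma (a - s + d + d) - Digamma (a - s + d)
      \<le> Digamma ((a + s) / 2 + d) - Digamma ((a + s) / 2)"
    using assms d by (intro Digamma_increment_antimono) (auto simp: field_simps)
  ultimately show ?thesis unfolding dmargin0_def e by linarith
qed

text \<open>
  For \<open>a \<ge> 3\<close> the function \<open>margin0 a\<close> is strictly convex on \<open>[0, 1]\<close>.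
\<close>

lemma dmargin0_strict_mono:
  assumes "0 \<le> s" "s < t" "t \<le> 1" "3 \<le> a"
  shows "dmargin0 a s < dmargin0 a t"
proof -
  define d where "d = (t - s) / 2"
  have d: "0 < d" "t = s + 2 * d" using assms by (auto simp: d_def field_simps)
  have e: "1 + t = 1 + s + 2 * d" "a - s = a - t + 2 * d"
     "(a - t + 2 * d) / 2 = (a - t) / 2 + d" "(a + t) / 2 = (a + s) / 2 + d"
    using d by (auto simp: field_simps)
  have "Digamma (a - t + 2 * d) - Digamma (a - t) \<le> Digamma (1 + s + 2 * d) - Digamma (1 + s)"
    using assms d by (intro Digamma_increment_antimono) auto
  moreover have "Digamma ((a + s) / 2 + d) - Digamma ((a + s) / 2)
      < Digamma ((a - t) / 2 + d) - Digamma ((a - t) / 2)"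
    using assms d by (intro Digamma_increment_strict_antimono) auto
  ultimately show ?thesis unfolding dmargin0_def e by linarith
qed

lemma ln_Gamma_plus1:
  fixes x :: real
  assumes "0 < x"
  shows "ln_Gamma (x + 1) = ln_Gamma x + ln x"
proof -
  have "Gamma (x + 1) = x * Gamma x"
    using assms by (intro Gamma_plus1) (auto elim!: nonpos_Ints_cases)
  then show ?thesis
    using assms less_imp_neq[OF Gamma_real_pos[OF assms]] by (auto simp: ln_Gamma_real_pos ln_mult)
qed

lemma margin0_0: "0 < a \<Longrightarrow> margin0 a 0 = 0"
  by (simp add: margin0_def ln_Gamma_real_pos)

lemma margin0_1:
  assumes "1 < a"
  shows "margin0 a 1 = ln (4 / (a - 1))"
proof -
  have "margin0 a 1 = ln (a - 1) - 2 * ln ((a - 1) / 2)"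
    using ln_Gamma_plus1[of "a - 1"] ln_Gamma_plus1[of "(a - 1) / 2"] ln_Gamma_plus1[of 1]
      ln_Gamma_real_pos[of 1] assms
    by (simp add: margin0_def field_simps)
  also have "\<dots> = ln (4 / (a - 1))"
    using assms ln_realpow[of 2 2] by (simp add: ln_div)
  finally show ?thesis .
qed

lemma margin0_less_max:
  assumes "3 \<le> a" "0 \<le> x" "x < y" "y < z" "z \<le> 1"
  shows "margin0 a y < max (margin0 a x) (margin0 a z)"
  by (rule between_less_max_if_deriv_strict_mono[where f = "margin0 a" and f' = "dmargin0 a"])
    (use assms in \<open>auto intro!: margin0_deriv dmargin0_strict_mono\<close>)

lemma margin0_5_neg: "0 < s \<Longrightarrow> s < 1 \<Longrightarrow> margin0 5 s < 0"
  using margin0_less_max[of 5 0 s 1] by (simp add: margin0_0 margin0_1)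

lemma dmargin0_4_0: "dmargin0 4 0 < 0"
  using Digamma_plus1[of "1::real"] Digamma_plus1[of "2::real"] Digamma_plus1[of "3::real"]
  by (simp add: dmargin0_def)

lemma ln_2_ge_691: "691 / 1000 \<le> ln (2::real)"
  using ln_approx_bounds[of 2 2] by (simp add: eval_nat_numeral)

text \<open>
  The slope at \<open>s = 0\<close> in dimension 7. It equals \<open>4 ln 2 - pi + 2/5\<close>, about \<open>0.03\<close>. The value of the
  digamma function at \<open>7/4\<close> is bounded by passing to \<open>15/4\<close> and extrapolating, by concavity, from the
  known values at 3 and \<open>7/2\<close>.
\<close>

lemma dmargin0_7_2_0: "0 \<le> dmargin0 (7/2) 0"
proof -
  have half: "Digamma (7/2 :: real) = 46 / 15 - euler_mascheroni - 2 * ln 2"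
    using Digamma_half_integer[of 3, where 'a = real] by (simp add: eval_nat_numeral)
  have one: "Digamma (1::real) = - euler_mascheroni" by simp
  have three: "Digamma (3::real) = 3 / 2 - euler_mascheroni"
    using Digamma_plus1[of "1::real"] Digamma_plus1[of "2::real"] by simp
  have "Digamma (15/4 :: real) = Digamma (7/4) + 4/7 + 4/11"
    using Digamma_plus1[of "7/4::real"] Digamma_plus1[of "11/4::real"] by simp
  \<comment> \<open>the increment after \<open>7/2\<close> is at most the mean of the two increments between 3 and \<open>7/2\<close>\<close>
  moreover have "Digamma (7/2 + 1/4) - Digamma (7/2) \<le> Digamma (13/4 + 1/4) - Digamma (13/4 :: real)"
    by (rule Digamma_increment_antimono) auto
  moreover have "Digamma (7/2 + 1/4) - Digamma (7/2) \<le> Digamma (3 + 1/4) - Digamma (3 :: real)"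
    by (rule Digamma_increment_antimono) auto
  ultimately have "2 * Digamma (7/4 :: real) \<le> 3 * Digamma (7/2) - Digamma 3 - 2 * (4/7 + 4/11)"
    by simp
  then show ?thesis
    using half one three ln_2_ge_691 by (simp add: dmargin0_def)
qed

lemma dmargin0_nonneg:
  assumes "0 \<le> s" "s < 1" "s < a" "a \<le> 7/2"
  shows "0 \<le> dmargin0 a s"
proof -
  have "dmargin0 (7/2) s \<le> dmargin0 a s"
    using dmargin0_strict_antimono_dim[of s a "7/2"] assms
    unfolding le_less[of a] by (elim disjE) (simp_all only: order_refl, auto)
  moreover have "dmargin0 (7/2) 0 \<le> dmargin0 (7/2) s"
    using dmargin0_strict_mono[of 0 s "7/2"] assms by (cases "s = 0") auto
  ultimately show ?thesis using dmargin0_7_2_0 by linarith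
qed

section \<open>Existence and finiteness of the Joseph-Lundgren exponent\<close>

text \<open>
  Let \<open>a\<close> be half the dimension, \<open>m = l / 2\<close> and \<open>t = (s + m) / (p - 1)\<close>. Then \<open>p > p_S\<close> means
  \<open>0 < t < (a - s) / 2\<close>, and up to the common factor \<open>2 powr (2 * s)\<close> the two sides of the defining
  inequality are the exponentials of \<open>log_lhs a m s t\<close> and \<open>log_rhs a s\<close>. Here \<open>t = 0\<close>, where
  \<open>log_lhs\<close> is still finite, stands for \<open>p = \<infinity>\<close>.
\<close>

definition log_lhs :: "real \<Rightarrow> real \<Rightarrow> real \<Rightarrow> real \<Rightarrow> real" where
  "log_lhs a m s t = ln (t + s + m) + ln_Gamma (a - t) + ln_Gamma (s + t)
     - ln_Gamma (t + 1) - ln_Gamma (a - s - t)"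

definition log_rhs :: "real \<Rightarrow> real \<Rightarrow> real" where
  "log_rhs a s = 2 * ln_Gamma ((a + s) / 2) - 2 * ln_Gamma ((a - s) / 2)"

text \<open>The derivative of \<open>log_lhs a m s\<close>.\<close>

definition dlog_lhs :: "real \<Rightarrow> real \<Rightarrow> real \<Rightarrow> real \<Rightarrow> real" where
  "dlog_lhs a m s t = 1 / (t + s + m) - Digamma (a - t) + Digamma (s + t)
     - Digamma (t + 1) + Digamma (a - s - t)"

text \<open>
  The value of \<open>log_lhs a m s 0 - log_rhs a s\<close>, the logarithm of the limiting quotient at
  \<open>p = \<infinity>\<close>. Its sign decides whether the Joseph-Lundgren exponent is finite.
\<close>

definition margin :: "real \<Rightarrow> real \<Rightarrow> real \<Rightarrow> real" where
  "margin a m s = ln (s + m) - ln s + margin0 a s"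

lemma exp_ln_Gamma: "0 < x \<Longrightarrow> exp (ln_Gamma x) = Gamma x" for x :: real
  by (simp add: ln_Gamma_real_pos)

lemma log_lhs_deriv:
  assumes "0 < s" "-s < m" "0 \<le> t" "t < a - s"
  shows "(log_lhs a m s has_real_derivative dlog_lhs a m s t) (at t)"
  unfolding log_lhs_def dlog_lhs_def using assms
  by (auto intro!: derivative_eq_intros simp: field_simps)

text \<open>
  So \<open>log_lhs a m s\<close> is strictly concave. The sign of \<open>m\<close> enters here: it makes
  \<open>1 / (t + s + m) - 1 / (t + s)\<close> decreasing in \<open>t\<close>.
\<close>

lemma dlog_lhs_strict_antimono:
  assumes "0 < s" "-s < m" "m \<le> 0" "0 \<le> t" "t < u" "u < a - s"
  shows "dlog_lhs a m s u < dlog_lhs a m s t"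
proof -
  have eq: "dlog_lhs a m s v = (Digamma (v + 1 + s) - Digamma (v + 1))
      - (Digamma (a - s - v + s) - Digamma (a - s - v)) + (- m) / ((v + s + m) * (v + s))"
    if "0 \<le> v" for v
  proof -
    have "Digamma (v + 1 + s) = Digamma (s + v) + 1 / (v + s)"
      using Digamma_plus1[of "v + s"] that assms by (simp add: algebra_simps)
    moreover have "1 / (v + s + m) - 1 / (v + s) = (- m) / ((v + s + m) * (v + s))"
      using that assms by (simp add: field_simps)
    ultimately show ?thesis unfolding dlog_lhs_def by simp
  qed
  have "Digamma (u + 1 + s) - Digamma (u + 1) < Digamma (t + 1 + s) - Digamma (t + 1)"
    using assms by (intro Digamma_increment_strict_antimono) auto
  moreover have "Digamma (a - s - t + s) - Digamma (a - s - t)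
      < Digamma (a - s - u + s) - Digamma (a - s - u)"
    using assms by (intro Digamma_increment_strict_antimono) auto
  moreover have "(- m) / ((u + s + m) * (u + s)) \<le> (- m) / ((t + s + m) * (t + s))"
    using assms by (intro divide_left_mono mult_mono mult_pos_pos) auto
  ultimately show ?thesis using assms by (simp add: eq)
qed

lemma log_lhs_greater_min:
  assumes "0 < s" "-s < m" "m \<le> 0" "0 \<le> x" "x < y" "y < z" "z < a - s"
  shows "min (log_lhs a m s x) (log_lhs a m s z) < log_lhs a m s y"
proof -
  have "- log_lhs a m s y < max (- log_lhs a m s x) (- log_lhs a m s z)"
    by (rule between_less_max_if_deriv_strict_mono[where f = "\<lambda>t. - log_lhs a m s t"
          and f' = "\<lambda>t. - dlog_lhs a m s t"])
      (use assms in \<open>auto intro!: DERIV_minus log_lhs_deriv dlog_lhs_strict_antimono\<close>)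
  then show ?thesis by linarith
qed

lemma log_lhs_0:
  assumes "0 < s"
  shows "log_lhs a m s 0 - log_rhs a s = margin a m s"
  using ln_Gamma_plus1[OF assms]
  by (simp add: log_lhs_def log_rhs_def margin_def margin0_def ln_Gamma_real_pos algebra_simps)

text \<open>
  At the end \<open>t = (a - s) / 2\<close>, which corresponds to \<open>p = p_S\<close>, the quotient of the two sides is
  \<open>p_S > 1\<close>.
\<close>

lemma log_lhs_end:
  assumes "0 < s" "-s < m" "s < a"
  shows "log_rhs a s < log_lhs a m s ((a - s) / 2)"
proof -
  define T where "T = (a - s) / 2"
  have T: "0 < T" using assms by (simp add: T_def)
  have e: "a - T = (a + s) / 2" "s + T = (a + s) / 2" "a - s - T = T" "(a - s) / 2 = T"
    by (auto simp: T_def field_simps)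
  have "ln T < ln (T + s + m)" using T assms by simp
  then show ?thesis
    using ln_Gamma_plus1[OF T] unfolding log_lhs_def log_rhs_def e by simp
qed

lemma lam_0:
  assumes "0 < s" "2 * s < real N"
  shows "lam N s 0 = 2 powr (2 * s) * exp (log_rhs (real N / 2) s)"
proof -
  have e: "(real N + 2 * s) / 4 = (real N / 2 + s) / 2" "(real N - 2 * s) / 4 = (real N / 2 - s) / 2"
    by (auto simp: field_simps)
  have "0 < (real N / 2 + s) / 2" "0 < (real N / 2 - s) / 2" using assms by auto
  then show ?thesis unfolding lam_def log_rhs_def exp_diff
    by (simp add: e exp_ln_Gamma exp_double power2_eq_square)
qed

lemma times_lam:
  assumes s: "0 < s" and t: "0 < t" "t < (real N / 2 - s) / 2" and l: "-2 * s < l"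
  defines "p \<equiv> 1 + (s + l / 2) / t"
  shows "p * lam N s ((real N - 2 * s) / 2 - (2 * s + l) / (p - 1))
       = 2 powr (2 * s) * exp (log_lhs (real N / 2) (l / 2) s t)"
proof -
  define a where "a = real N / 2"
  have "(2 * s + l) / (p - 1) = 2 * t"
    using s t l by (simp add: p_def field_simps)
  then have "lam N s ((real N - 2 * s) / 2 - (2 * s + l) / (p - 1)) = lam N s (a - s - 2 * t)"
    by (simp add: a_def diff_divide_distrib)
  also have "\<dots> = 2 powr (2 * s) * ((Gamma (a - t) * Gamma (s + t)) / (Gamma t * Gamma (a - s - t)))"
  proof -
    have e: "(real N + 2 * s + 2 * (a - s - 2 * t)) / 4 = a - t"
      "(real N + 2 * s - 2 * (a - s - 2 * t)) / 4 = s + t"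
      "(real N - 2 * s - 2 * (a - s - 2 * t)) / 4 = t"
      "(real N - 2 * s + 2 * (a - s - 2 * t)) / 4 = a - s - t"
      by (auto simp: a_def field_simps)
    show ?thesis unfolding lam_def e ..
  qed
  finally have lam: "lam N s ((real N - 2 * s) / 2 - (2 * s + l) / (p - 1)) = \<dots>" .
  have pos: "0 < t + s + l / 2" "0 < a - t" "0 < s + t" "0 < t + 1" "0 < a - s - t"
    using s t l by (auto simp: a_def)
  have "Gamma (t + 1) = t * Gamma t"
    using t by (intro Gamma_plus1) (auto elim!: nonpos_Ints_cases)
  then have "exp (log_lhs a (l / 2) s t)
      = (t + s + l / 2) * Gamma (a - t) * Gamma (s + t) / (t * Gamma t * Gamma (a - s - t))"
    unfolding log_lhs_def exp_diff exp_add using pos by (simp add: exp_ln_Gamma)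
  moreover have "p = (t + s + l / 2) / t" using t by (simp add: p_def field_simps)
  ultimately show ?thesis unfolding lam a_def[symmetric] by (simp add: mult_ac)
qed

lemma const_divide_less_iff:
  fixes c x y :: real
  assumes "0 < c" "0 < x" "0 < y"
  shows "c / x < c / y \<longleftrightarrow> y < x"
  using assms by (simp add: mult_less_cancel_left divide_simps)

lemma p_S_less_iff:
  assumes s: "0 < s" and t: "0 < t" and l: "-2 * s < l" and N: "2 * s < real N"
  shows "p_S N s l < 1 + (s + l / 2) / t \<longleftrightarrow> t < (real N / 2 - s) / 2"
proof -
  have "p_S N s l = 1 + (s + l / 2) / ((real N / 2 - s) / 2)"
    using N by (simp add: p_S_def field_simps)
  then have "p_S N s l < 1 + (s + l / 2) / t
      \<longleftrightarrow> (s + l / 2) / ((real N / 2 - s) / 2) < (s + l / 2) / t"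
    by simp
  also have "\<dots> \<longleftrightarrow> t < (real N / 2 - s) / 2"
    using assms by (intro const_divide_less_iff) auto
  finally show ?thesis .
qed

lemma p_S_gt_1:
  assumes "0 < s" "-2 * s < l" "2 * s < real N"
  shows "1 < p_S N s l"
  using assms by (simp add: p_S_def field_simps)

lemma JL_iff:
  assumes s: "0 < s" and t: "0 < t" "t < (real N / 2 - s) / 2" and l: "-2 * s < l"
  shows "JL_subcritical N s l (1 + (s + l / 2) / t)
      \<longleftrightarrow> log_rhs (real N / 2) s < log_lhs (real N / 2) (l / 2) s t" (is ?A)
    and "JL_critical N s l (1 + (s + l / 2) / t)
      \<longleftrightarrow> log_lhs (real N / 2) (l / 2) s t = log_rhs (real N / 2) s" (is ?B)
    and "JL_supercritical N s l (1 + (s + l / 2) / t)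
      \<longleftrightarrow> log_lhs (real N / 2) (l / 2) s t < log_rhs (real N / 2) s" (is ?C)
proof -
  have N: "2 * s < real N" using t by simp
  have "p_S N s l < 1 + (s + l / 2) / t" using p_S_less_iff[OF s t(1) l N] t by simp
  moreover have "1 < 1 + (s + l / 2) / t" using s t l by simp
  moreover have "2 powr (2 * s) * x < 2 powr (2 * s) * y \<longleftrightarrow> x < y"
      "2 powr (2 * s) * x = 2 powr (2 * s) * y \<longleftrightarrow> x = y" for x y :: real
    by (simp_all add: mult_less_cancel_left)
  ultimately show ?A ?B ?C
    unfolding JL_subcritical_def JL_critical_def JL_supercritical_def times_lam[OF s t l] lam_0[OF s N]
    by auto
qed

lemma is_p_JL_unique:
  assumes "is_p_JL N s l P" "is_p_JL N s l Q" "1 < p_S N s l"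
  shows "P = Q"
proof -
  have "\<not> P < Q" if P: "is_p_JL N s l P" and Q: "is_p_JL N s l Q" for P Q
  proof
    assume "P < Q"
    then obtain q where q: "P = ereal q"
      using P unfolding is_p_JL_def by (cases P) auto
    have "JL_critical N s l q" using P q by (auto simp: is_p_JL_def)
    moreover have "JL_subcritical N s l q"
      using Q q \<open>P < Q\<close> \<open>JL_critical N s l q\<close> by (auto simp: is_p_JL_def JL_critical_def)
    ultimately show False by (auto simp: JL_critical_def JL_subcritical_def)
  qed
  from this[OF assms(1,2)] this[OF assms(2,1)] show ?thesis by simp
qed

text \<open>
  The strictly concave function \<open>log_lhs\<close> ends above the level \<open>log_rhs\<close>. If it starts below this
  level, it crosses it exactly once; otherwise it lies above the level on the whole open interval.
\<close>

lemma is_p_JL_exists: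
  fixes N :: nat and s l :: real
  assumes s: "0 < s" and N: "2 * s < real N" and l: "-2 * s < l" "l \<le> 0"
  shows "\<exists>P. is_p_JL N s l P \<and> (P < \<infinity> \<longleftrightarrow> margin (real N / 2) (l / 2) s < 0)"
proof -
  define f where "f = log_lhs (real N / 2) (l / 2) s"
  define c where "c = log_rhs (real N / 2) s"
  \<comment> \<open>\<open>T\<close> is the parameter of \<open>p_S\<close>, and \<open>p\<close> inverts the substitution \<open>t = (s + l / 2) / (p - 1)\<close>\<close>
  define T where "T = (real N / 2 - s) / 2"
  define p where "p t = 1 + (s + l / 2) / t" for t
  have T: "0 < T" "T < real N / 2 - s" using N by (auto simp: T_def)
  have fT: "c < f T" unfolding c_def f_def T_def using s l N by (intro log_lhs_end) auto
  have conc: "min (f x) (f z) < f y" if "0 \<le> x" "x < y" "y < z" "z \<le> T" for x y z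
    unfolding f_def using that s l T by (intro log_lhs_greater_min) auto
  have cont: "continuous_on {0..T} f"
  proof -
    have "(f has_real_derivative dlog_lhs (real N / 2) (l / 2) s t) (at t)" if "t \<in> {0..T}" for t
      unfolding f_def using that s l T by (intro log_lhs_deriv) auto
    then show ?thesis by (meson DERIV_isCont continuous_at_imp_continuous_on)
  qed
  have JL: "JL_subcritical N s l (p t) \<longleftrightarrow> c < f t" "JL_critical N s l (p t) \<longleftrightarrow> f t = c"
      "JL_supercritical N s l (p t) \<longleftrightarrow> f t < c" "p_S N s l < p t"
    if "0 < t" "t < T" for t
    using JL_iff[OF s that(1) _ l(1), of N] p_S_less_iff[OF s that(1) l(1) N] that
    unfolding T_def f_def c_def p_def by auto
  have reparam: "\<exists>t. 0 < t \<and> t < T \<and> q = p t" if q: "p_S N s l < q" for q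
  proof -
    define t where "t = (s + l / 2) / (q - 1)"
    have "1 < q" using q p_S_gt_1[OF s l(1) N] by simp
    then have t: "0 < t" "q = p t" using s l by (auto simp: t_def p_def)
    then show ?thesis using q p_S_less_iff[OF s t(1) l(1) N] by (auto simp: p_def T_def)
  qed
  have p_less: "p t < p u \<longleftrightarrow> u < t" if "0 < t" "0 < u" for t u
  proof -
    have "0 < s + l / 2" using l by simp
    then show ?thesis unfolding p_def using that const_divide_less_iff by simp
  qed
  have sub: "JL_subcritical N s l q" if "1 < q" "q \<le> p_S N s l" for q
    using that by (simp add: JL_subcritical_def)
  have margin: "margin (real N / 2) (l / 2) s = f 0 - c"
    using log_lhs_0[OF s] by (simp add: f_def c_def)
  show ?thesis
  proof (cases "f 0 < c")
    case True
    then obtain t0 where t0: "0 \<le> t0" "t0 \<le> T" "f t0 = c"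
      using IVT'[of f 0 c T] fT T cont by auto
    with True fT have t0': "0 < t0" "t0 < T" by (auto simp: le_less)
    have above: "c < f t" if "t0 < t" "t < T" for t
      using conc[of t0 t T] that t0 fT by auto
    have below: "f t < c" if "0 < t" "t < t0" for t
      using conc[of t t0 T] that t0 t0' fT by auto
    have "is_p_JL N s l (ereal (p t0))"
      unfolding is_p_JL_def
    proof (intro conjI allI impI)
      show "ereal (p_S N s l) < ereal (p t0)" using JL(4)[OF t0'] by simp
    next
      fix q assume q: "1 < q \<and> ereal q < ereal (p t0)"
      show "JL_subcritical N s l q"
      proof (cases "q \<le> p_S N s l")
        case False
        then obtain t where t: "0 < t" "t < T" "q = p t" using reparam[of q] by auto
        then show ?thesis using q p_less[OF t(1) t0'(1)] above[of t] JL(1)[OF t(1,2)] by auto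
      qed (use q sub in auto)
    next
      fix q assume "ereal (p t0) = ereal q"
      then show "JL_critical N s l q" using JL(2)[OF t0'] t0 by simp
    next
      fix q r assume "ereal (p t0) = ereal q" "q < r"
      then have r: "p t0 < r" by simp
      then obtain t where t: "0 < t" "t < T" "r = p t"
        using reparam[of r] JL(4)[OF t0'] by auto
      then show "JL_supercritical N s l r"
        using r p_less[OF t0'(1) t(1)] below[of t] JL(3)[OF t(1,2)] by auto
    qed
    with True margin show ?thesis by (intro exI[of _ "ereal (p t0)"]) auto
  next
    case False
    have "is_p_JL N s l \<infinity>"
      unfolding is_p_JL_def
    proof (intro conjI allI impI)
      fix q assume q: "1 < q \<and> ereal q < \<infinity>"
      show "JL_subcritical N s l q"
      proof (cases "q \<le> p_S N s l")
        case False
        then obtain t where t: "0 < t" "t < T" "q = p t" using reparam[of q] by auto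
        have "c < f t" using conc[of 0 t T] t T fT \<open>\<not> f 0 < c\<close> by auto
        then show ?thesis using JL(1)[OF t(1,2)] t by auto
      qed (use q sub in auto)
    qed auto
    with False margin show ?thesis by (intro exI[of _ "\<infinity>"]) auto
  qed
qed

lemma is_p_JL_ex1:
  assumes "0 < s" "2 * s < real N" "-2 * s < l" "l \<le> 0"
  shows "\<exists>!P. is_p_JL N s l P"
  using is_p_JL_exists[OF assms] is_p_JL_unique p_S_gt_1[of s l N] assms by blast

lemma p_JL_finite_iff:
  assumes "0 < s" "2 * s < real N" "-2 * s < l" "l \<le> 0"
  shows "p_JL N s l < \<infinity> \<longleftrightarrow> margin (real N / 2) (l / 2) s < 0"
proof -
  obtain P where P: "is_p_JL N s l P" "P < \<infinity> \<longleftrightarrow> margin (real N / 2) (l / 2) s < 0"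
    using is_p_JL_exists[OF assms] by blast
  then have "p_JL N s l = P"
    unfolding p_JL_def using is_p_JL_ex1[OF assms] by (intro the1_equality)
  with P show ?thesis by simp
qed

lemma p_JL_infinite_iff:
  assumes "0 < s" "2 * s < real N" "-2 * s < l" "l \<le> 0"
  shows "p_JL N s l = \<infinity> \<longleftrightarrow> 0 \<le> margin (real N / 2) (l / 2) s"
  using p_JL_finite_iff[OF assms] by (metis ereal_infty_less(1) not_le)

section \<open>The case \<open>l = 0\<close>\<close>

lemma margin_eq_margin0: "margin a 0 s = margin0 a s"
  by (simp add: margin_def)

lemma margin0_nonneg_small_dim:
  assumes "0 < s" "s < 1" "s < a" "a \<le> 7/2"
  shows "0 \<le> margin0 a s"
proof -
  have "margin0 a 0 \<le> margin0 a s"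
  proof (rule DERIV_nonneg_imp_nondecreasing[where f = "margin0 a"])
    fix u assume "0 \<le> u" "u \<le> s"
    then show "\<exists>y. (margin0 a has_real_derivative y) (at u) \<and> 0 \<le> y"
      using assms by (intro exI[of _ "dmargin0 a u"] conjI margin0_deriv dmargin0_nonneg) auto
  qed (use assms in auto)
  then show ?thesis using assms by (simp add: margin0_0)
qed

lemma margin0_neg_large_dim: "0 < s \<Longrightarrow> s < 1 \<Longrightarrow> 5 \<le> a \<Longrightarrow> margin0 a s < 0"
  using margin0_antimono_dim[of s 5 a] margin0_5_neg[of s] by auto

text \<open>
  Half-dimensions between 4 and 5: the convex function \<open>margin0 a\<close> vanishes at 0, where its slope is
  negative, and is positive at 1.
\<close>

lemma margin0_single_crossing:
  assumes "4 \<le> a" "a < 5"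
  obtains r where "0 < r" "r < 1" "\<And>s. 0 < s \<Longrightarrow> s < r \<Longrightarrow> margin0 a s < 0"
    "\<And>s. r \<le> s \<Longrightarrow> s < 1 \<Longrightarrow> 0 \<le> margin0 a s"
proof -
  have "dmargin0 a 0 \<le> dmargin0 4 0"
    using dmargin0_strict_antimono_dim[of 0 4 a] assms by (cases "a = 4") auto
  then have neg: "dmargin0 a 0 < 0" using dmargin0_4_0 by simp
  have "(margin0 a has_real_derivative dmargin0 a 0) (at 0)" using assms by (intro margin0_deriv) auto
  from DERIV_neg_dec_right[OF this neg] obtain d where
    d: "0 < d" "\<And>x. 0 < x \<Longrightarrow> x < d \<Longrightarrow> margin0 a x < margin0 a 0" by auto
  define x where "x = min (d / 2) (1 / 2)"
  have x: "0 < x" "x < 1" "x < d" using d by (auto simp: x_def)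
  have hx: "margin0 a x < 0" using d x margin0_0[of a] assms by force
  have h1: "0 < margin0 a 1" using assms by (simp add: margin0_1)
  have "(margin0 a has_real_derivative dmargin0 a u) (at u)" if "u \<in> {x..1}" for u
    using that assms x by (intro margin0_deriv) auto
  then have "continuous_on {x..1} (margin0 a)"
    by (meson DERIV_isCont continuous_at_imp_continuous_on)
  then obtain r where r: "x \<le> r" "r \<le> 1" "margin0 a r = 0"
    using IVT'[of "margin0 a" x 0 1] hx h1 x by auto
  then have r': "0 < r" "r < 1" using x h1 by (auto simp: less_le)
  show thesis
  proof (rule that[OF r'])
    fix s assume "0 < s" "s < r"
    then show "margin0 a s < 0" using margin0_less_max[of a 0 s r] r r' assms by (simp add: margin0_0)
  next
    fix s assume s: "r \<le> s" "s < 1"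
    show "0 \<le> margin0 a s"
    proof (cases "s = r")
      case False
      then show ?thesis using margin0_less_max[of a 0 r s] s r r' assms by (auto simp: margin0_0)
    qed (use r in simp)
  qed
qed

section \<open>The case \<open>l < 0\<close>\<close>

lemma margin_1: "1 < a \<Longrightarrow> -1 < m \<Longrightarrow> margin a m 1 = ln (4 * (1 + m) / (a - 1))"
  using ln_mult[of 4 "1 + m"] by (simp add: margin_def margin0_1 ln_div del: distrib_left_numeral)

lemma margin_strict_mono:
  assumes m: "m < 0" and s: "- m < s" "s < t" "t < 1" "t < a" and a: "a \<le> 7/2"
  shows "margin a m s < margin a m t"
proof (rule DERIV_pos_imp_increasing[OF s(2)])
  fix u assume u: "s \<le> u" "u \<le> t"
  have "(margin a m has_real_derivative (1 / (u + m) - 1 / u + dmargin0 a u)) (at u)"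
    unfolding margin_def using m s u by (auto intro!: derivative_eq_intros margin0_deriv)
  moreover have "1 / u < 1 / (u + m)" using m s u by (intro divide_strict_left_mono) auto
  moreover have "0 \<le> dmargin0 a u" using m s u a by (intro dmargin0_nonneg) auto
  ultimately show "\<exists>D. (margin a m has_real_derivative D) (at u) \<and> 0 < D"
    by (intro exI[of _ "1 / (u + m) - 1 / u + dmargin0 a u"]) auto
qed

text \<open>
  For \<open>m < 0\<close> and \<open>- m < s < a\<close> this function has the sign of \<open>margin a m s\<close>, which becomes infinite at
  both ends of this interval. It arises by removing the logarithms and multiplying by \<open>(a - s)^2\<close>; this
  makes it continuous up to both ends, where its sign can be read off.
\<close>

definition sign_fun :: "real \<Rightarrow> real \<Rightarrow> real \<Rightarrow> real" where
  "sign_fun a m s = 4 * (s + m) * Gamma a * Gamma s * Gamma ((a - s) / 2 + 1) ^ 2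
     - (a - s) * Gamma (a - s + 1) * Gamma ((a + s) / 2) ^ 2"

lemma sgn_margin:
  assumes "0 < s" "-m < s" "s < a"
  shows "sgn (margin a m s) = sgn (sign_fun a m s)"
proof -
  define X where "X = (s + m) * Gamma a * Gamma s * Gamma ((a - s) / 2) ^ 2"
  define Y where "Y = Gamma (a - s) * Gamma ((a + s) / 2) ^ 2"
  have pos: "0 < Gamma a" "0 < Gamma s" "0 < Gamma ((a - s) / 2)" "0 < Gamma (a - s)"
      "0 < Gamma ((a + s) / 2)"
    using assms by (auto intro!: Gamma_real_pos)
  have XY: "0 < X" "0 < Y"
    unfolding X_def Y_def using assms by (intro mult_pos_pos zero_less_power pos; simp)+
  have "margin a m s = log_lhs a m s 0 - log_rhs a s"
    using log_lhs_0[of s a m] assms by simp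
  also have "\<dots> = ln X - ln Y"
    unfolding log_lhs_def log_rhs_def X_def Y_def using assms pos
    by (simp add: ln_Gamma_real_pos ln_mult ln_realpow pos[THEN less_imp_neq, THEN not_sym])
  finally have margin: "margin a m s = ln X - ln Y" .
  have Gamma: "Gamma ((a - s) / 2 + 1) = (a - s) / 2 * Gamma ((a - s) / 2)"
       "Gamma (a - s + 1) = (a - s) * Gamma (a - s)"
    using assms by (intro Gamma_plus1; auto elim!: nonpos_Ints_cases)+
  have "4 * (s + m) * A * B * (w / 2 * C) ^ 2 - w * (w * D) * E ^ 2
      = w ^ 2 * ((s + m) * A * B * C ^ 2 - D * E ^ 2)" for A B C D E w :: real
    by (simp add: power2_eq_square algebra_simps)
  then have "sign_fun a m s = (a - s) ^ 2 * (X - Y)"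
    unfolding sign_fun_def X_def Y_def Gamma .
  moreover have "sgn ((a - s) ^ 2) = 1"
    using assms by (simp add: sgn_1_pos)
  moreover have "sgn (ln X - ln Y) = sgn (X - Y)"
    using XY by (cases X Y rule: linorder_cases) auto
  ultimately show ?thesis by (simp add: margin sgn_mult)
qed

lemma margin_sign:
  assumes "0 < s" "-m < s" "s < a"
  shows "margin a m s < 0 \<longleftrightarrow> sign_fun a m s < 0" "margin a m s = 0 \<longleftrightarrow> sign_fun a m s = 0"
    "0 < margin a m s \<longleftrightarrow> 0 < sign_fun a m s"
  using sgn_margin[OF assms] by (auto simp: sgn_if split: if_splits)

lemma continuous_on_sign_fun:
  assumes "0 < x" "y \<le> a"
  shows "continuous_on {x..y} (sign_fun a m)"
proof -
  have "continuous_on {0<..} (Gamma :: real \<Rightarrow> real)"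
    by (intro continuous_on_Gamma) (auto elim!: nonpos_Ints_cases)
  then have Gamma: "continuous_on {x..y} (\<lambda>s. Gamma (g s))"
    if "continuous_on {x..y} g" "g ` {x..y} \<subseteq> {0<..}" for g :: "real \<Rightarrow> real"
    using that by (rule continuous_on_compose2)
  show ?thesis
    unfolding sign_fun_def[abs_def] using assms
    by (intro continuous_intros Gamma) (auto intro!: add_nonneg_pos)
qed

lemma sign_fun_start: "m < 0 \<Longrightarrow> - m < a \<Longrightarrow> sign_fun a m (- m) < 0"
  by (auto simp: sign_fun_def intro!: mult_pos_pos Gamma_real_pos zero_less_power)

text \<open>
  To be used with \<open>b = min 1 a\<close>, the right end of the range of \<open>s\<close>.
\<close>

lemma sign_fun_end:
  assumes "m < 0" "- m < b" "b = a \<or> b = 1 \<and> 1 < a \<and> a < 5 + 4 * m"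
  shows "0 < sign_fun a m b"
proof (cases "b = a")
  case True
  then show ?thesis using assms by (auto simp: sign_fun_def intro!: mult_pos_pos Gamma_real_pos)
next
  case False
  with assms have "b = 1" "1 < a" "a < 5 + 4 * m" by auto
  moreover from this have "0 < margin a m 1" by (simp add: margin_1)
  ultimately show ?thesis using margin_sign(3)[of 1 m a] assms by simp
qed

lemma margin_near_ends:
  assumes m: "m < 0" "- m < b" and b: "b \<le> a" "0 < sign_fun a m b"
  obtains s1 s2 where "- m < s1" "s1 \<le> s2" "s2 < b"
    "\<And>s. - m < s \<Longrightarrow> s < s1 \<Longrightarrow> margin a m s < 0"
    "\<And>s. s2 \<le> s \<Longrightarrow> s < b \<Longrightarrow> 0 \<le> margin a m s"
proof -
  have cont: "continuous_on {- m..b} (sign_fun a m)"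
    using m b by (intro continuous_on_sign_fun) auto
  obtain d where d: "0 < d" "\<And>s. s \<in> {- m..b} \<Longrightarrow> dist s (- m) < d \<Longrightarrow> sign_fun a m s < 0"
    using cont[unfolded continuous_on_iff, rule_format, of "- m" "- sign_fun a m (- m)"]
      sign_fun_start[of m a] m b by (force simp: dist_real_def)
  obtain e where e: "0 < e" "\<And>s. s \<in> {- m..b} \<Longrightarrow> dist s b < e \<Longrightarrow> 0 < sign_fun a m s"
    using cont[unfolded continuous_on_iff, rule_format, of b "sign_fun a m b"] m b
    by (force simp: dist_real_def)
  define r where "r = min (min d e) ((b + m) / 2)"
  have r: "0 < r" "r \<le> d" "r \<le> e" "2 * r \<le> b + m" using d e m by (auto simp: r_def min_def)
  show thesis
  proof (rule that[of "- m + r" "b - r / 2"])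
    fix s assume "- m < s" "s < - m + r"
    then show "margin a m s < 0"
      using d(2)[of s] r m b margin_sign(1)[of s m a] by (auto simp: dist_real_def)
  next
    fix s assume "b - r / 2 \<le> s" "s < b"
    then show "0 \<le> margin a m s"
      using e(2)[of s] r m b margin_sign(3)[of s m a] by (auto simp: dist_real_def)
  qed (use r in auto)
qed

lemma margin_single_crossing:
  assumes m: "m < 0" "- m < b" and b: "b \<le> a" "b \<le> 1" "0 < sign_fun a m b" and a: "a \<le> 7/2"
  obtains s1 where "- m < s1" "s1 < b"
    "\<And>s. - m < s \<Longrightarrow> s < s1 \<Longrightarrow> margin a m s < 0"
    "\<And>s. s1 \<le> s \<Longrightarrow> s < b \<Longrightarrow> 0 \<le> margin a m s"
proof -
  have "continuous_on {- m..b} (sign_fun a m)"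
    using m b by (intro continuous_on_sign_fun) auto
  then obtain s1 where s1: "- m \<le> s1" "s1 \<le> b" "sign_fun a m s1 = 0"
    using IVT'[of "sign_fun a m" "- m" 0 b] sign_fun_start[of m a] m b by auto
  moreover have "s1 \<noteq> - m" "s1 \<noteq> b" using s1 sign_fun_start[of m a] m b by auto
  ultimately have s1': "- m < s1" "s1 < b" by auto
  then have zero: "margin a m s1 = 0" using margin_sign(2)[of s1 m a] s1 m b by simp
  show thesis
  proof (rule that[OF s1'])
    fix s assume "- m < s" "s < s1"
    then show "margin a m s < 0"
      using margin_strict_mono[of m s s1 a] zero m b a s1' by simp
  next
    fix s assume "s1 \<le> s" "s < b"
    then show "0 \<le> margin a m s"
      using margin_strict_mono[of m s1 s a] zero m b a s1' by (cases "s = s1") auto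
  qed
qed

text \<open>
  By monotonicity in the dimension only \<open>a = 5 + 4 * m\<close> matters; this is the value for which the margin
  vanishes at \<open>s = 1\<close>. For fixed \<open>s < 1\<close> the margin strictly increases with \<open>m\<close> along this line, so it
  is bounded by its value at \<open>m = 0\<close>, which is \<open>margin0 5 s < 0\<close>.
\<close>

lemma margin_neg_large_dim:
  assumes m: "m < 0" and s: "- m < s" "s < 1" and a: "5 + 4 * m \<le> a"
  shows "margin a m s < 0"
proof -
  have s0: "0 < s" using m s by simp
  have "margin0 a s \<le> margin0 (5 + 4 * m) s"
    using s m a by (intro margin0_antimono_dim) auto
  moreover have "ln (s + m) - ln s + margin0 (5 + 4 * m) s < ln (s + 0) - ln s + margin0 (5 + 4 * 0) s"
  proof (rule DERIV_pos_imp_increasing[OF m])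
    fix u assume u: "m \<le> u" "u \<le> (0::real)"
    define c where "c = 5 + 4 * u"
    have c: "s < c" "1 < c" "0 < s + u" using u s by (auto simp: c_def)
    define D where "D = Digamma c - Digamma (c - s) - (Digamma ((c + s) / 2) - Digamma ((c - s) / 2))"
    have "((\<lambda>a. margin0 a s) has_real_derivative D) (at (5 + 4 * u))"
      using margin0_deriv_dim[of s c] s0 c unfolding D_def c_def by simp
    then have der: "((\<lambda>u. ln (s + u) - ln s + margin0 (5 + 4 * u) s) has_real_derivative
        (1 / (s + u) + D * 4)) (at u)"
      using c by (auto intro!: derivative_eq_intros DERIV_chain2[where f = "\<lambda>a. margin0 a s"])
    have e: "(c - s) / 2 + s = (c + s) / 2" "(c - s) / 2 - (1 - s) / 2 = (c - 1) / 2"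
      by (auto simp: field_simps)
    have "s / (c - s) \<le> Digamma c - Digamma (c - s)"
      using Digamma_increment_ge[of "c - s" s] s s0 c by simp
    moreover have "Digamma ((c + s) / 2) - Digamma ((c - s) / 2) \<le> s / ((c - 1) / 2)"
      using Digamma_increment_le[of s "(c - s) / 2"] s s0 c unfolding e by simp
    ultimately have "s / (c - s) - s / ((c - 1) / 2) \<le> D" by (simp add: D_def)
    moreover have "4 * (s / ((c - 1) / 2) - s / (c - s)) < 1 / (s + u)"
    proof -
      \<comment> \<open>with \<open>q = 4 * (s + u)\<close> written in terms of \<open>c\<close>; at \<open>s = 1\<close> the claim would be an equality\<close>
      define q where "q = c - 1 - 4 * (1 - s)"
      have q: "4 * (s + u) = q" "0 < q" using c by (auto simp: q_def c_def)
      have "s / ((c - 1) / 2) - s / (c - s) = s * (c + 1 - 2 * s) / ((c - 1) * (c - s))"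
        using c by (simp add: field_simps)
      moreover have "s * (c + 1 - 2 * s) * q < (c - 1) * (c - s)"
      proof -
        have "(c - 1) * (c - s) - (c + 1 - 2 * s) * q = (1 - s) * (3 * (c - 1) + 8 * (1 - s))"
          unfolding q_def by (simp add: algebra_simps)
        also have "\<dots> > 0" using s c by simp
        finally have "(c + 1 - 2 * s) * q < (c - 1) * (c - s)" by simp
        moreover have "s * ((c + 1 - 2 * s) * q) \<le> 1 * ((c + 1 - 2 * s) * q)"
          using s s0 c q by (intro mult_right_mono) auto
        ultimately show ?thesis by (simp add: mult_ac)
      qed
      ultimately have "s / ((c - 1) / 2) - s / (c - s) < 1 / q"
        using q c by (simp add: divide_simps mult_ac)
      moreover have "1 / (s + u) = 4 * (1 / q)" using q c by (simp add: field_simps)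
      ultimately show ?thesis by (simp only: mult_less_cancel_left_pos zero_less_numeral)
    qed
    ultimately have "0 < 1 / (s + u) + D * 4" by simp
    with der show "\<exists>y. ((\<lambda>u. ln (s + u) - ln s + margin0 (5 + 4 * u) s) has_real_derivative y) (at u) \<and> 0 < y"
      by blast
  qed
  moreover have "margin0 5 s < 0" using s s0 by (intro margin0_5_neg) auto
  ultimately show ?thesis unfolding margin_def by simp
qed

section \<open>The classification\<close>

theorem theorem1p2:
  shows
   "(\<forall>(N::nat) (s::real) (l::real).
       1 \<le> N \<and> 0 < s \<and> s < 1 \<and> real N > 2 * s \<and> -2 * s < l \<and> l \<le> 0 \<longrightarrow>
       (\<exists>!P::ereal. is_p_JL N s l P))
    \<and>
    ((\<forall>s::real. 0 < s \<and> s < 1/2 \<longrightarrow> p_JL 1 s 0 = \<infinity>) \<and>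
     (\<forall>(N::nat) (s::real). 2 \<le> N \<and> N \<le> 7 \<and> 0 < s \<and> s < 1 \<longrightarrow> p_JL N s 0 = \<infinity>) \<and>
     (\<forall>N::nat. N = 8 \<or> N = 9 \<longrightarrow>
        (\<exists>!sN::real. 0 < sN \<and> sN < 1 \<and>
           (\<forall>s. 0 < s \<and> s < sN \<longrightarrow> p_JL N s 0 < \<infinity>) \<and>
           (\<forall>s. sN \<le> s \<and> s < 1 \<longrightarrow> p_JL N s 0 = \<infinity>))) \<and>
     (\<forall>(N::nat) (s::real). 10 \<le> N \<and> 0 < s \<and> s < 1 \<longrightarrow> p_JL N s 0 < \<infinity>))
    \<and>
    (\<forall>(N::nat) (l::real). 1 \<le> N \<and> -2 < l \<and> l < 0 \<and> (N = 1 \<longrightarrow> l > -1) \<longrightarrow>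
       (N = 1 \<longrightarrow>
          (\<exists>s1::real. -l/2 < s1 \<and> s1 < 1/2 \<and>
             (\<forall>s. -l/2 < s \<and> s < s1 \<longrightarrow> p_JL N s l < \<infinity>) \<and>
             (\<forall>s. s1 \<le> s \<and> s < 1/2 \<longrightarrow> p_JL N s l = \<infinity>))) \<and>
       (2 \<le> N \<and> real N < 10 + 4 * l \<longrightarrow>
          (\<exists>(s1::real) (s2::real). -l/2 < s1 \<and> s1 < 1 \<and> -l/2 < s2 \<and> s2 < 1 \<and> s1 \<le> s2 \<and>
             (\<forall>s. -l/2 < s \<and> s < s1 \<longrightarrow> p_JL N s l < \<infinity>) \<and>
             (\<forall>s. s2 \<le> s \<and> s < 1 \<longrightarrow> p_JL N s l = \<infinity>) \<and>
             (N \<le> 6 \<longrightarrow> s1 = s2))) \<and>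
       (real N \<ge> 10 + 4 * l \<longrightarrow>
          (\<forall>s. -l/2 < s \<and> s < 1 \<longrightarrow> p_JL N s l < \<infinity>)))"
  (is "?I \<and> (?IIa1 \<and> ?IIa2 \<and> ?IIb \<and> ?IIc) \<and> ?III")
proof -
  have inf0: "p_JL N s 0 = \<infinity> \<longleftrightarrow> 0 \<le> margin0 (real N / 2) s"
    and fin0: "p_JL N s 0 < \<infinity> \<longleftrightarrow> margin0 (real N / 2) s < 0"
    if "0 < s" "2 * s < real N" for N s
    using p_JL_infinite_iff[of s N 0] p_JL_finite_iff[of s N 0] that by (auto simp: margin_eq_margin0)
  have ?I using is_p_JL_ex1 by blast
  moreover have ?IIa1
    using inf0[of _ 1] by (auto intro!: margin0_nonneg_small_dim)
  moreover have ?IIa2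
    using inf0 by (auto intro!: margin0_nonneg_small_dim)
  moreover have ?IIb
  proof (intro allI impI)
    fix N :: nat assume N: "N = 8 \<or> N = 9"
    then have "4 \<le> real N / 2" "real N / 2 < 5" and less_N: "s < 1 \<Longrightarrow> 2 * s < real N" for s
      by auto
    then obtain r where r: "0 < r" "r < 1" "\<And>s. 0 < s \<Longrightarrow> s < r \<Longrightarrow> margin0 (real N / 2) s < 0"
      "\<And>s. r \<le> s \<Longrightarrow> s < 1 \<Longrightarrow> 0 \<le> margin0 (real N / 2) s"
      using margin0_single_crossing[of "real N / 2"] by blast
    show "\<exists>!sN::real. 0 < sN \<and> sN < 1 \<and>
           (\<forall>s. 0 < s \<and> s < sN \<longrightarrow> p_JL N s 0 < \<infinity>) \<and>
           (\<forall>s. sN \<le> s \<and> s < 1 \<longrightarrow> p_JL N s 0 = \<infinity>)"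
    proof (rule ex1I[of _ r])
      show "0 < r \<and> r < 1 \<and> (\<forall>s. 0 < s \<and> s < r \<longrightarrow> p_JL N s 0 < \<infinity>) \<and>
           (\<forall>s. r \<le> s \<and> s < 1 \<longrightarrow> p_JL N s 0 = \<infinity>)"
        using r inf0[OF _ less_N] fin0[OF _ less_N] by auto
      then show "t = r" if "0 < t \<and> t < 1 \<and> (\<forall>s. 0 < s \<and> s < t \<longrightarrow> p_JL N s 0 < \<infinity>) \<and>
           (\<forall>s. t \<le> s \<and> s < 1 \<longrightarrow> p_JL N s 0 = \<infinity>)" for t
        using that by (metis linorder_neqE_linordered_idom order_refl less_irrefl)
    qed
  qed
  moreover have ?IIc
    using fin0 by (auto intro!: margin0_neg_large_dim)
  moreover have ?III
  proof (intro allI impI conjI)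
    fix N :: nat and l :: real
    assume Nl: "1 \<le> N \<and> -2 < l \<and> l < 0 \<and> (N = 1 \<longrightarrow> l > -1)"
    define a m where "a = real N / 2" and "m = l / 2"
    have m: "m < 0" using Nl by (simp add: m_def)
    have inf: "p_JL N s l = \<infinity>" if "- m < s" "s < a" "0 \<le> margin a m s" for s
      using p_JL_infinite_iff[of s N l] that Nl by (simp add: a_def m_def)
    have fin: "p_JL N s l < \<infinity>" if "- m < s" "s < a" "margin a m s < 0" for s
      using p_JL_finite_iff[of s N l] that Nl by (simp add: a_def m_def)
    have m': "- l / 2 = - m" by (simp add: m_def)
    {
      assume "N = 1"
      then have a: "a = 1/2" "- m < a" using Nl by (auto simp: a_def m_def)
      then have a_le: "a \<le> a" "a \<le> 1" "a \<le> 7/2" by auto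
      have E: "0 < sign_fun a m a" using sign_fun_end[OF m a(2)] by blast
      obtain s1 where s1: "- m < s1" "s1 < a"
        "\<And>s. - m < s \<Longrightarrow> s < s1 \<Longrightarrow> margin a m s < 0"
        "\<And>s. s1 \<le> s \<Longrightarrow> s < a \<Longrightarrow> 0 \<le> margin a m s"
        using margin_single_crossing[OF m a(2) a_le(1,2) E a_le(3)] by blast
      show "\<exists>s1::real. -l/2 < s1 \<and> s1 < 1/2 \<and>
             (\<forall>s. -l/2 < s \<and> s < s1 \<longrightarrow> p_JL N s l < \<infinity>) \<and>
             (\<forall>s. s1 \<le> s \<and> s < 1/2 \<longrightarrow> p_JL N s l = \<infinity>)"
        unfolding m' a(1)[symmetric]
        using s1(1,2) inf[OF less_le_trans[OF s1(1)] _ s1(4)] fin[OF _ less_trans[OF _ s1(2)] s1(3)]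
        by blast
    next
      assume N: "2 \<le> N \<and> real N < 10 + 4 * l"
      then have a: "1 \<le> a" "a < 5 + 4 * m" "- m < 1" using Nl by (auto simp: a_def m_def)
      then have E: "0 < sign_fun a m 1" using sign_fun_end[of m 1 a] m by (cases "a = 1") auto
      show "\<exists>(s1::real) (s2::real). -l/2 < s1 \<and> s1 < 1 \<and> -l/2 < s2 \<and> s2 < 1 \<and> s1 \<le> s2 \<and>
             (\<forall>s. -l/2 < s \<and> s < s1 \<longrightarrow> p_JL N s l < \<infinity>) \<and>
             (\<forall>s. s2 \<le> s \<and> s < 1 \<longrightarrow> p_JL N s l = \<infinity>) \<and>
             (N \<le> 6 \<longrightarrow> s1 = s2)"
      proof (cases "N \<le> 6")
        case True
        then have "a \<le> 7/2" by (simp add: a_def)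
        with m a E obtain s1 where "- m < s1" "s1 < 1"
          "\<And>s. - m < s \<Longrightarrow> s < s1 \<Longrightarrow> margin a m s < 0"
          "\<And>s. s1 \<le> s \<Longrightarrow> s < 1 \<Longrightarrow> 0 \<le> margin a m s"
          using margin_single_crossing[of m 1 a] by auto
        then show ?thesis
          unfolding m' using inf fin a by (intro exI[of _ s1]) auto
      next
        case False
        from m a E obtain s1 s2 where "- m < s1" "s1 \<le> s2" "s2 < 1"
          "\<And>s. - m < s \<Longrightarrow> s < s1 \<Longrightarrow> margin a m s < 0"
          "\<And>s. s2 \<le> s \<Longrightarrow> s < 1 \<Longrightarrow> 0 \<le> margin a m s"
          using margin_near_ends[of m 1 a] by auto
        with False show ?thesis
          unfolding m' using inf fin a by (intro exI[of _ s1] exI[of _ s2]) auto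
      qed
    next
      fix s assume "10 + 4 * l \<le> real N" "- l / 2 < s \<and> s < 1"
      then show "p_JL N s l < \<infinity>"
        using m by (intro fin margin_neg_large_dim) (auto simp: a_def m_def)
    }
  qed
  ultimately show ?thesis by blast
qed

end
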